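(* There is an absolute constant $C>0$ such that the following holds. Let $G$ be a maximal planar graph with $n\ge 4$ vertices, and consider any planar straight-line drawing of $G$ in the hyperbolic plane. Then the vertex-edge resolution of the drawing is at most $C/\sqrt{n}$.
   Context: The hyperbolic plane is the complete simply connected Riemannian surface of constant curvature $-1$. A planar straight-line hyperbolic drawing of a graph places the vertices at distinct points of the hyperbolic plane and draws each edge as the hyperbolic geodesic segment between its endpoints, so that no two edges intersect except at a common endpoint and no edge passes through a vertex other than its endpoints. The vertex-edge resolution of a drawing is the minimum, over all pairs consisting of a vertex $v$ and an edge $e$ not incident to $v$, of the hyperbolic distance from $v$ to the segment $e$. A maximal planar graph is a planar graph to which no edge can be added while preserving planarity. *)

theory Defs
  imports "HOL-Analysis.Analysis"
begin

section \<open>Hyperbolic plane: Poincare disk model\<close>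

definition hyp_disk :: "complex set" where
  "hyp_disk = {z. norm z < 1}"

definition hdist :: "complex \<Rightarrow> complex \<Rightarrow> real" where
  "hdist z w = arcosh (1 + 2 * (norm (z - w))^2 / ((1 - (norm z)^2) * (1 - (norm w)^2)))"

definition hseg :: "complex \<Rightarrow> complex \<Rightarrow> complex set" where
  "hseg a b = {x \<in> hyp_disk. hdist a x + hdist x b = hdist a b}"

definition hdist_set :: "complex \<Rightarrow> complex set \<Rightarrow> real" where
  "hdist_set x S = Inf (hdist x ` S)"

definition simple_graph :: "nat set \<Rightarrow> nat set set \<Rightarrow> bool" where
  "simple_graph V E \<longleftrightarrow> finite V \<and> (\<forall>e\<in>E. e \<subseteq> V \<and> card e = 2)"

definition planar_embedding ::
  "nat set \<Rightarrow> nat set set \<Rightarrow> (nat \<Rightarrow> complex) \<Rightarrow> (nat set \<Rightarrow> real \<Rightarrow> complex) \<Rightarrow> bool" where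
  "planar_embedding V E p \<gamma> \<longleftrightarrow>
     inj_on p V \<and>
     (\<forall>e\<in>E. arc (\<gamma> e) \<and> {pathstart (\<gamma> e), pathfinish (\<gamma> e)} = p ` e \<and>
              path_image (\<gamma> e) \<inter> p ` V = p ` e) \<and>
     (\<forall>e\<in>E. \<forall>e'\<in>E. e \<noteq> e' \<longrightarrow> path_image (\<gamma> e) \<inter> path_image (\<gamma> e') \<subseteq> p ` (e \<inter> e'))"

definition planar :: "nat set \<Rightarrow> nat set set \<Rightarrow> bool" where
  "planar V E \<longleftrightarrow> simple_graph V E \<and> (\<exists>p \<gamma>. planar_embedding V E p \<gamma>)"

definition maximal_planar :: "nat set \<Rightarrow> nat set set \<Rightarrow> bool" where
  "maximal_planar V E \<longleftrightarrow> planar V E \<and>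
     (\<forall>u\<in>V. \<forall>v\<in>V. u \<noteq> v \<longrightarrow> {u, v} \<notin> E \<longrightarrow> \<not> planar V (insert {u, v} E))"

definition hyp_straight_line_drawing :: "nat set \<Rightarrow> nat set set \<Rightarrow> (nat \<Rightarrow> complex) \<Rightarrow> bool" where
  "hyp_straight_line_drawing V E p \<longleftrightarrow>
     p ` V \<subseteq> hyp_disk \<and> inj_on p V \<and>
     (\<forall>u w u' w'. {u, w} \<in> E \<longrightarrow> {u', w'} \<in> E \<longrightarrow> {u, w} \<noteq> {u', w'} \<longrightarrow>
        hseg (p u) (p w) \<inter> hseg (p u') (p w') \<subseteq> p ` ({u, w} \<inter> {u', w'})) \<and>
     (\<forall>v\<in>V. \<forall>u w. {u, w} \<in> E \<longrightarrow> v \<notin> {u, w} \<longrightarrow> p v \<notin> hseg (p u) (p w))"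

definition vertex_edge_resolution :: "nat set \<Rightarrow> nat set set \<Rightarrow> (nat \<Rightarrow> complex) \<Rightarrow> real" where
  "vertex_edge_resolution V E p =
     Inf {hdist_set (p v) (hseg (p u) (p w)) | v u w. v \<in> V \<and> {u, w} \<in> E \<and> v \<notin> {u, w}}"

end

theory Submission
  imports Defs
begin

text \<open>
  In a projective model of the hyperbolic plane the drawing becomes a Euclidean straight-line drawing.
  Two extreme points of the convex hull of the vertices can be joined by an arc outside the hull, so by
  maximality they are adjacent; four of them would give two crossing edges by Radon's theorem. Hence the
  hull is a triangle whose sides are edges, and it has bounded area. If the resolution is \<open>\<delta>\<close>, the disc of
  radius \<open>\<delta>\<close> around any of the other \<open>n - 3\<close> vertices stays inside this triangle. Two vertices at distance
  less than \<open>\<delta>\<close> are joined by an isolated edge, again by maximality, so half of these vertices are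
  \<open>\<delta>\<close>-separated, and their disjoint discs of radius \<open>\<delta> / 2\<close> have area at least of order \<open>\<delta>\<^sup>2\<close> each.
\<close>

section \<open>The parabola model\<close>

text \<open>
  The Cayley transform to the upper half-plane \<open>x + iy\<close> followed by \<open>(x, y) \<mapsto> (x, x\<^sup>2 + y\<^sup>2)\<close>; a circle
  orthogonal to the real axis becomes a line. The function \<open>height\<close> recovers \<open>y\<close>.
\<close>

definition para :: "complex \<Rightarrow> complex" where
  "para z = Complex (- 2 * Im z / (cmod (1 - z))\<^sup>2) ((cmod (1 + z))\<^sup>2 / (cmod (1 - z))\<^sup>2)"

text \<open>The interior of a parabola, projectively equivalent to the Klein disk, with the boundary
  point \<open>1\<close> of the Poincare disk sent to infinity.\<close>

definition para_dom :: "complex set" where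
  "para_dom = {c. (Re c)\<^sup>2 < Im c}"

definition height :: "complex \<Rightarrow> real" where
  "height c = sqrt (Im c - (Re c)\<^sup>2)"

text \<open>The hyperbolic cosine of the half-plane distance. The numerator, a polar form of
  \<open>Im c - (Re c)\<^sup>2\<close>, is affine in each argument.\<close>

definition lform :: "complex \<Rightarrow> complex \<Rightarrow> real" where
  "lform c d = (Im c + Im d - 2 * Re c * Re d) / (2 * height c * height d)"

definition pdist :: "complex \<Rightarrow> complex \<Rightarrow> real" where
  "pdist c d = arcosh (lform c d)"

lemma height_pos: "c \<in> para_dom \<Longrightarrow> height c > 0"
  by (simp add: height_def para_dom_def)

lemma height_sq: "c \<in> para_dom \<Longrightarrow> (height c)\<^sup>2 = Im c - (Re c)\<^sup>2"
  by (simp add: height_def para_dom_def)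

section \<open>Isometry between the Poincare disk and the parabola model\<close>

lemma disk_cmod_pos:
  assumes "z \<in> hyp_disk"
  shows "(cmod (1 - z))\<^sup>2 > 0" "1 - (cmod z)\<^sup>2 > 0"
proof -
  have "cmod z < 1" using assms by (simp add: hyp_disk_def)
  then show "1 - (cmod z)\<^sup>2 > 0" by (simp add: abs_square_less_1)
  have "z \<noteq> 1" using \<open>cmod z < 1\<close> by auto
  then show "(cmod (1 - z))\<^sup>2 > 0" by simp
qed

text \<open>The Cayley transform sends \<open>z\<close> to \<open>i (1 + z) / (1 - z)\<close>, whose
  imaginary part is squared on the right. Without denominators this is
  \<open>|1 - z^2|^2 - 4 (Im z)^2 = (1 - |z|^2)^2\<close>.\<close>

lemma para_discriminant:
  assumes "z \<in> hyp_disk"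
  shows "Im (para z) - (Re (para z))\<^sup>2 = ((1 - (cmod z)\<^sup>2) / (cmod (1 - z))\<^sup>2)\<^sup>2"
proof -
  define M where "M = (cmod (1 - z))\<^sup>2"
  have M: "M > 0" using disk_cmod_pos[OF assms] by (simp add: M_def)
  have "(cmod (1 + z))\<^sup>2 * M - (2 * Im z)\<^sup>2 = (1 - (cmod z)\<^sup>2)\<^sup>2"
    unfolding M_def cmod_power2 by (simp add: power2_eq_square algebra_simps)
  then have "((cmod (1 + z))\<^sup>2 * M - (2 * Im z)\<^sup>2) / M\<^sup>2 = ((1 - (cmod z)\<^sup>2) / M)\<^sup>2"
    by (simp add: power_divide)
  moreover have "((cmod (1 + z))\<^sup>2 * M - (2 * Im z)\<^sup>2) / M\<^sup>2
      = (cmod (1 + z))\<^sup>2 / M - (- 2 * Im z / M)\<^sup>2"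
    using M by (simp add: field_simps power2_eq_square)
  ultimately show ?thesis by (simp add: para_def M_def)
qed

lemma para_in_dom: 
  assumes "z \<in> hyp_disk" shows "para z \<in> para_dom"
proof -
  have "((1 - (cmod z)\<^sup>2) / (cmod (1 - z))\<^sup>2)\<^sup>2 > 0"
    using disk_cmod_pos[OF assms] by (intro zero_less_power[OF divide_pos_pos])
  then have "Im (para z) - (Re (para z))\<^sup>2 > 0" by (simp only: para_discriminant[OF assms])
  then show ?thesis by (simp add: para_dom_def)
qed

lemma height_para:
  assumes "z \<in> hyp_disk"
  shows "height (para z) = (1 - (cmod z)\<^sup>2) / (cmod (1 - z))\<^sup>2"
  using para_discriminant[OF assms] disk_cmod_pos[OF assms] by (simp add: height_def)

text \<open>This makes \<open>para\<close> an isometry: once the factors \<open>M\<close> and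
  \<open>N\<close> cancel, the polynomial identity \<open>key\<close> remains.\<close>

lemma lform_para:
  assumes "z \<in> hyp_disk" "w \<in> hyp_disk"
  shows "lform (para z) (para w) = 
    1 + 2 * (cmod (z - w))\<^sup>2 / ((1 - (cmod z)\<^sup>2) * (1 - (cmod w)\<^sup>2))"
proof -
  define M N where "M = (cmod (1 - z))\<^sup>2" and "N = (cmod (1 - w))\<^sup>2"
  define A B where "A = 1 - (cmod z)\<^sup>2" and "B = 1 - (cmod w)\<^sup>2"
  have pos: "M > 0" "N > 0" "A > 0" "B > 0" 
    using disk_cmod_pos[OF assms(1)] disk_cmod_pos[OF assms(2)] by (auto simp: M_def N_def A_def B_def)
  have key: "(cmod (1 + z))\<^sup>2 * N + (cmod (1 + w))\<^sup>2 * M - 8 * Im z * Im w = 2 * (A * B + 2 * (cmod (z - w))\<^sup>2)"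
    unfolding M_def N_def A_def B_def cmod_power2 by (simp add: power2_eq_square algebra_simps)
  have "lform (para z) (para w) =
     ((cmod (1 + z))\<^sup>2 / M + (cmod (1 + w))\<^sup>2 / N - 2 * (- 2 * Im z / M) * (- 2 * Im w / N)) / (2 * (A / M) * (B / N))"
    unfolding lform_def height_para[OF assms(1)] height_para[OF assms(2)] A_def B_def M_def N_def
    by (simp add: para_def)
  also have "\<dots> = ((cmod (1 + z))\<^sup>2 * N + (cmod (1 + w))\<^sup>2 * M - 8 * Im z * Im w) / (2 * (A * B))"
    using pos by (simp add: field_simps)
  also have "\<dots> = 1 + 2 * (cmod (z - w))\<^sup>2 / (A * B)"
    unfolding key using pos by (simp add: field_simps)
  finally show ?thesis by (simp add: A_def B_def)
qed

lemma hdist_eq_pdist: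
  assumes "z \<in> hyp_disk" "w \<in> hyp_disk"
  shows "hdist z w = pdist (para z) (para w)"
  by (simp add: hdist_def pdist_def lform_para assms)

lemma lform_self: "c \<in> para_dom \<Longrightarrow> lform c c = 1"
  using height_pos[of c] height_sq[of c] by (simp add: lform_def power2_eq_square)

lemma inj_on_para: "inj_on para hyp_disk"
proof (rule inj_onI)
  fix z w assume *: "z \<in> hyp_disk" "w \<in> hyp_disk" "para z = para w"
  have "lform (para z) (para w) = 1"
    using lform_self[OF para_in_dom[OF *(1)]] *(3) by simp
  then show "z = w"
    unfolding lform_para[OF *(1,2)]
    using disk_cmod_pos[OF *(1)] disk_cmod_pos[OF *(2)] by auto
qed

lemma para_surj:
  assumes "c \<in> para_dom"
  obtains z where "z \<in> hyp_disk" "para z = c"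
proof -
  define x y where "x = Re c" and "y = height c"
  have y: "y > 0" "y\<^sup>2 = Im c - x\<^sup>2" 
    using height_pos[OF assms] height_sq[OF assms] by (auto simp: x_def y_def)
  define M where "M = x\<^sup>2 + (y + 1)\<^sup>2"
  have M: "M > 0" using y by (simp add: M_def add_nonneg_pos)
  \<comment> \<open>The inverse Cayley transform \<open>(\<zeta> - i) / (\<zeta> + i)\<close> at
    \<open>\<zeta> = x + i y\<close>, with \<open>M = |\<zeta> + i|^2\<close>.\<close>
  define z where "z = Complex ((x\<^sup>2 + y\<^sup>2 - 1) / M) (- 2 * x / M)"
  have n1: "(cmod (1 - z))\<^sup>2 = 4 / M"
  proof -
    have "1 - z = Complex ((M - (x\<^sup>2 + y\<^sup>2 - 1)) / M) (2 * x / M)"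
      using M by (simp add: complex_eq_iff z_def field_simps)
    then have "(cmod (1 - z))\<^sup>2 = ((M - (x\<^sup>2 + y\<^sup>2 - 1)) / M)\<^sup>2 + (2 * x / M)\<^sup>2"
      unfolding cmod_power2 by (simp only: complex.sel)
    then have "(cmod (1 - z))\<^sup>2 = ((M - (x\<^sup>2 + y\<^sup>2 - 1))\<^sup>2 + (2 * x)\<^sup>2) / M\<^sup>2"
      by (simp only: power_divide flip: add_divide_distrib)
    also have "(M - (x\<^sup>2 + y\<^sup>2 - 1))\<^sup>2 + (2 * x)\<^sup>2 = 4 * M"
      by (simp add: M_def power2_eq_square algebra_simps)
    finally show ?thesis using M by (simp add: power2_eq_square)
  qed
  have n2: "(cmod (1 + z))\<^sup>2 = 4 * (x\<^sup>2 + y\<^sup>2) / M"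
  proof -
    have "1 + z = Complex ((M + (x\<^sup>2 + y\<^sup>2 - 1)) / M) (- 2 * x / M)"
      using M by (simp add: complex_eq_iff z_def field_simps)
    then have "(cmod (1 + z))\<^sup>2 = ((M + (x\<^sup>2 + y\<^sup>2 - 1)) / M)\<^sup>2 + (2 * x / M)\<^sup>2"
      unfolding cmod_power2 by (simp only: complex.sel) simp
    then have "(cmod (1 + z))\<^sup>2 = ((M + (x\<^sup>2 + y\<^sup>2 - 1))\<^sup>2 + (2 * x)\<^sup>2) / M\<^sup>2"
      by (simp only: power_divide flip: add_divide_distrib)
    also have "(M + (x\<^sup>2 + y\<^sup>2 - 1))\<^sup>2 + (2 * x)\<^sup>2 = 4 * (x\<^sup>2 + y\<^sup>2) * M"
      by (simp add: M_def power2_eq_square algebra_simps)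
    finally show ?thesis using M by (simp add: power2_eq_square)
  qed
  have "(cmod z)\<^sup>2 = ((x\<^sup>2 + y\<^sup>2 - 1)\<^sup>2 + (2 * x)\<^sup>2) / M\<^sup>2"
    using M by (simp add: cmod_power2 z_def add_divide_distrib power_divide)
  also have "(x\<^sup>2 + y\<^sup>2 - 1)\<^sup>2 + (2 * x)\<^sup>2 = (M - 4 * y) * M"
    by (simp add: M_def power2_eq_square algebra_simps)
  also have "\<dots> / M\<^sup>2 = 1 - 4 * y / M"
    using M by (simp add: power2_eq_square field_simps)
  also have "\<dots> < 1" using M y by simp
  finally have "z \<in> hyp_disk" by (simp add: hyp_disk_def abs_square_less_1)
  moreover have "para z = c"
    unfolding para_def n1 n2 using M y by (auto simp: z_def complex_eq_iff x_def)
  ultimately show ?thesis using that by blast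
qed

text \<open>The usual half-plane formula at abscissa \<open>Re\<close> and ordinate
  \<open>height\<close>; it makes the bound \<open>lform c d \<ge> 1\<close> visible.\<close>

lemma lform_alt:
  assumes "c \<in> para_dom" "d \<in> para_dom"
  shows "lform c d = 1 + ((Re c - Re d)\<^sup>2 + (height c - height d)\<^sup>2) / (2 * height c * height d)"
proof -
  note p = height_pos[OF assms(1)] height_pos[OF assms(2)]
  have "Im c + Im d - 2 * Re c * Re d 
      = 2 * height c * height d + ((Re c - Re d)\<^sup>2 + (height c - height d)\<^sup>2)"
    using height_sq[OF assms(1)] height_sq[OF assms(2)] by (simp add: power2_eq_square algebra_simps)
  then show ?thesis using p by (simp add: lform_def field_simps)
qed

lemma lform_ge_1: "c \<in> para_dom \<Longrightarrow> d \<in> para_dom \<Longrightarrow> lform c d \<ge> 1"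
  using height_pos[of c] height_pos[of d] by (simp add: lform_alt)

lemma lform_commute: "lform c d = lform d c"
  by (simp add: lform_def algebra_simps)

lemma pdist_commute: "pdist c d = pdist d c"
  by (simp add: pdist_def lform_commute)

lemma pdist_nonneg: "c \<in> para_dom \<Longrightarrow> d \<in> para_dom \<Longrightarrow> pdist c d \<ge> 0"
  by (simp add: pdist_def lform_ge_1)

lemma cosh_pdist: "c \<in> para_dom \<Longrightarrow> d \<in> para_dom \<Longrightarrow> cosh (pdist c d) = lform c d"
  by (simp add: pdist_def lform_ge_1)

lemma convex_para_dom: "convex para_dom"
proof -
  have cs: "convex_on UNIV (\<lambda>x::real. x\<^sup>2)" by (rule convex_power2)
  show ?thesis
    unfolding convex_alt
  proof (intro ballI allI impI)
    fix c d u assume c: "c \<in> para_dom" and d: "d \<in> para_dom" and u: "0 \<le> u \<and> u \<le> (1::real)"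
    have "((1 - u) * Re c + u * Re d)\<^sup>2 \<le> (1 - u) * (Re c)\<^sup>2 + u * (Re d)\<^sup>2"
      using convex_onD[OF cs, of u "Re c" "Re d"] u by simp
    also have "\<dots> < (1 - u) * Im c + u * Im d"
    proof (cases "u = 0")
      \<comment> \<open>Strictness comes from \<open>d\<close> unless its weight vanishes, and then
        from \<open>c\<close>.\<close>
      case False
      then have "u * (Re d)\<^sup>2 < u * Im d" using d u by (simp add: para_dom_def)
      moreover have "(1 - u) * (Re c)\<^sup>2 \<le> (1 - u) * Im c" 
        using c u by (intro mult_left_mono) (auto simp: para_dom_def)
      ultimately show ?thesis by linarith
    qed (use c in \<open>simp add: para_dom_def\<close>)
    finally show "(1 - u) *\<^sub>R c + u *\<^sub>R d \<in> para_dom" by (simp add: para_dom_def)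
  qed
qed

text \<open>
  Lift \<open>c\<close> to \<open>(1, Re c, Im c) / height c\<close>, a vector of norm 1 for the Lorentzian form polarised in
  \<open>lform\<close>. The pair \<open>(tanx d c, tany d c)\<close> consists of its coordinates in the (definite) orthogonal
  complement of the lift of \<open>d\<close>, so that the triangle inequality becomes the Cauchy-Schwarz inequality.
\<close>

definition tanx :: "complex \<Rightarrow> complex \<Rightarrow> real" where
  "tanx d c = (Re c - Re d) / height c"

definition tany :: "complex \<Rightarrow> complex \<Rightarrow> real" where
  "tany d c = (Im c - 2 * Re c * Re d + (Re d)\<^sup>2 - (height d)\<^sup>2) / (2 * height c * height d)"

text \<open>Splits the lifts of \<open>c\<close> and \<open>e\<close> along that of
  \<open>d\<close>. The form is negative definite on the orthogonal complement, hence the minus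
  sign.\<close>

lemma lform_tan:
  assumes "c \<in> para_dom" "d \<in> para_dom" "e \<in> para_dom"
  shows "lform c e = lform c d * lform d e - (tanx d c * tanx d e + tany d c * tany d e)"
proof -
  note p = height_pos[OF assms(1)] height_pos[OF assms(2)] height_pos[OF assms(3)]
  define h where "h = height d"
  have h: "h > 0" using p by (simp add: h_def)
  have hd: "Im d = h\<^sup>2 + (Re d)\<^sup>2" using height_sq[OF assms(2)] by (simp add: h_def)
  define A B C where "A = Im c + Im e - 2 * Re c * Re e"
    and "B = Im c + Im d - 2 * Re c * Re d" and "C = Im d + Im e - 2 * Re d * Re e"
  define X X' Y Y' where "X = Re c - Re d" and "X' = Re e - Re d"
    and "Y = Im c - 2 * Re c * Re d + (Re d)\<^sup>2 - h\<^sup>2"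
    and "Y' = Im e - 2 * Re e * Re d + (Re d)\<^sup>2 - h\<^sup>2"
  have key: "2 * h\<^sup>2 * A = B * C - 4 * h\<^sup>2 * X * X' - Y * Y'"
    unfolding A_def B_def C_def X_def X'_def Y_def Y'_def hd
    by (simp add: power2_eq_square algebra_simps)
  have "lform c e = 2 * h\<^sup>2 * A / (4 * height c * height e * h\<^sup>2)"
    using p h by (simp add: lform_def A_def[symmetric])
  also have "\<dots> = (B / (2 * height c * h)) * (C / (2 * h * height e))
      - (X / height c * (X' / height e) + Y / (2 * height c * h) * (Y' / (2 * height e * h)))"
    unfolding key using p h by (simp add: diff_divide_distrib add_divide_distrib power2_eq_square mult_ac)
  finally show ?thesis
    by (simp add: lform_def tanx_def tany_def A_def B_def C_def X_def X'_def Y_def Y'_def h_def)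
qed

text \<open>The case \<open>e = c\<close> of \<open>lform_tan\<close>, where the left-hand side is
  1, compared with \<open>cosh^2 - sinh^2 = 1\<close>.\<close>

lemma sinh_pdist:
  assumes "c \<in> para_dom" "d \<in> para_dom"
  shows "sinh (pdist c d) = sqrt ((tanx d c)\<^sup>2 + (tany d c)\<^sup>2)"
proof -
  have "(tanx d c)\<^sup>2 + (tany d c)\<^sup>2 = (lform c d)\<^sup>2 - 1"
    using lform_tan[OF assms assms(1)] lform_self[OF assms(1)]
    by (simp add: power2_eq_square lform_commute[of d c])
  also have "\<dots> = (sinh (pdist c d))\<^sup>2"
    using cosh_pdist[OF assms] cosh_square_eq[of "pdist c d"] by simp
  finally show ?thesis using pdist_nonneg[OF assms] by simp
qed

lemma pdist_triangle:
  assumes "c \<in> para_dom" "d \<in> para_dom" "e \<in> para_dom"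
  shows "pdist c e \<le> pdist c d + pdist d e"
proof -
  have cs: "- (a * a' + b * b') \<le> sqrt (a\<^sup>2 + b\<^sup>2) * sqrt (a'\<^sup>2 + b'\<^sup>2)" for a b a' b' :: real
  proof -
    have "(a\<^sup>2 + b\<^sup>2) * (a'\<^sup>2 + b'\<^sup>2) - (- (a * a' + b * b'))\<^sup>2 = (a * b' - b * a')\<^sup>2" by algebra
    then have "(- (a * a' + b * b'))\<^sup>2 \<le> (a\<^sup>2 + b\<^sup>2) * (a'\<^sup>2 + b'\<^sup>2)"
      using zero_le_power2[of "a * b' - b * a'"] by linarith
    then show ?thesis
      unfolding real_sqrt_mult[symmetric] by (rule real_le_rsqrt)
  qed
  have "cosh (pdist c e) = lform c e" by (simp add: cosh_pdist assms)
  also have "\<dots> \<le> cosh (pdist c d) * cosh (pdist d e) + sinh (pdist c d) * sinh (pdist d e)"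
    using lform_tan[OF assms] cs[of "tanx d c" "tanx d e" "tany d c" "tany d e"]
    by (simp add: cosh_pdist assms sinh_pdist[OF assms(1,2)] sinh_pdist[OF assms(3,2)] pdist_commute[of d e] lform_commute)
  also have "\<dots> = cosh (pdist c d + pdist d e)" by (simp add: cosh_add)
  finally show ?thesis
    by (subst (asm) cosh_real_nonneg_le_iff) (auto simp: pdist_nonneg assms)
qed

text \<open>Seen from \<open>c\<close>, the tangential vectors of \<open>a\<close> and
  \<open>b\<close> are opposite multiples of one vector \<open>(X, Y)\<close>, so Cauchy-Schwarz,
  and with it the triangle inequality, is an equality.\<close>

lemma pdist_segment:
  assumes "a \<in> para_dom" "b \<in> para_dom" "c \<in> closed_segment a b"
  shows "c \<in> para_dom" "pdist a c + pdist c b = pdist a b"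
proof -
  show c: "c \<in> para_dom"
    using convex_para_dom assms by (meson closed_segment_subset subsetD)
  obtain t where t: "0 \<le> t" "t \<le> 1" and ct: "c = (1 - t) *\<^sub>R a + t *\<^sub>R b"
    using assms(3) by (auto simp: in_segment)
  note p = height_pos[OF assms(1)] height_pos[OF assms(2)] height_pos[OF c]
  define X where "X = Re a - Re b"
  define Y where "Y = (Im a - Im b - 2 * Re c * (Re a - Re b)) / (2 * height c)"
  have R: "Re c = (1 - t) * Re a + t * Re b" and I: "Im c = (1 - t) * Im a + t * Im b" by (auto simp: ct)
  have xa: "tanx c a = t / height a * X" "tanx c b = - ((1 - t) / height b * X)"
    using p by (simp_all add: tanx_def X_def R field_simps)
  have ya: "tany c a = t / height a * Y"
  proof -
    have "Im a - 2 * Re a * Re c + (Re c)\<^sup>2 - (height c)\<^sup>2 = t * (Im a - Im b - 2 * Re c * (Re a - Re b))"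
      unfolding height_sq[OF c] R I by algebra
    then show ?thesis using p by (simp add: tany_def Y_def)
  qed
  have yb: "tany c b = - ((1 - t) / height b * Y)"
  proof -
    have "Im b - 2 * Re b * Re c + (Re c)\<^sup>2 - (height c)\<^sup>2 = - ((1 - t) * (Im a - Im b - 2 * Re c * (Re a - Re b)))"
      unfolding height_sq[OF c] R I by algebra
    then show ?thesis using p by (simp add: tany_def Y_def)
  qed
  have sq: "sqrt ((k * X)\<^sup>2 + (k * Y)\<^sup>2) = k * sqrt (X\<^sup>2 + Y\<^sup>2)" if "k \<ge> 0" for k
    using that by (simp add: power_mult_distrib distrib_left[symmetric] real_sqrt_mult)
  have s: "sinh (pdist a c) = t / height a * sqrt (X\<^sup>2 + Y\<^sup>2)"
       "sinh (pdist c b) = (1 - t) / height b * sqrt (X\<^sup>2 + Y\<^sup>2)"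
    unfolding sinh_pdist[OF assms(1) c] pdist_commute[of c b] sinh_pdist[OF assms(2) c] xa ya yb power2_minus
    by (rule sq, use p t in simp)+
  have "cosh (pdist a c + pdist c b) = lform a c * lform c b + sinh (pdist a c) * sinh (pdist c b)"
    by (simp add: cosh_add cosh_pdist assms c)
  also have "sinh (pdist a c) * sinh (pdist c b) = (t / height a) * ((1 - t) / height b) * (X\<^sup>2 + Y\<^sup>2)"
  proof -
    have "sqrt (X\<^sup>2 + Y\<^sup>2) * sqrt (X\<^sup>2 + Y\<^sup>2) = X\<^sup>2 + Y\<^sup>2" by simp
    then show ?thesis unfolding s by algebra
  qed
  also have "\<dots> = - (tanx c a * tanx c b + tany c a * tany c b)"
    unfolding xa ya yb by algebra
  also have "lform a c * lform c b + \<dots> = lform a b"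
    using lform_tan[OF assms(1) c assms(2)] by simp
  also have "\<dots> = cosh (pdist a b)" by (simp add: cosh_pdist assms)
  finally show "pdist a c + pdist c b = pdist a b"
    by (metis arcosh_cosh_real pdist_nonneg assms(1,2) c add_nonneg_nonneg)
qed

lemma pdist_segment_le:
  assumes "a \<in> para_dom" "b \<in> para_dom" "y \<in> closed_segment a b"
  shows "pdist a y \<le> pdist a b" "pdist b y \<le> pdist a b"
  using pdist_segment(2)[OF assms] pdist_nonneg[OF assms(1) pdist_segment(1)[OF assms]]
    pdist_nonneg[OF assms(2) pdist_segment(1)[OF assms]] by (simp_all add: pdist_commute[of b y])

section \<open>Maximal straight-line drawings\<close>

text \<open>Purely affine data, as they arise from a hyperbolic drawing through \<open>para\<close>;
  the metric enters in \<open>separated_drawing\<close>.\<close>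

locale straight_drawing =
  fixes V :: "nat set" and E :: "nat set set" and q :: "nat \<Rightarrow> complex"
  assumes graph: "simple_graph V E"
    and inj: "inj_on q V"
    and edges_meet: "{u, w} \<in> E \<Longrightarrow> {u', w'} \<in> E \<Longrightarrow> {u, w} \<noteq> {u', w'} \<Longrightarrow>
        closed_segment (q u) (q w) \<inter> closed_segment (q u') (q w') \<subseteq> q ` ({u, w} \<inter> {u', w'})"
    and vertex_edge: "v \<in> V \<Longrightarrow> {u, w} \<in> E \<Longrightarrow> v \<notin> {u, w} \<Longrightarrow> q v \<notin> closed_segment (q u) (q w)"
begin

lemma edge_in: "{u, w} \<in> E \<Longrightarrow> u \<in> V \<and> w \<in> V \<and> u \<noteq> w"
proof -
  assume "{u, w} \<in> E"
  then have "{u, w} \<subseteq> V" "card {u, w} = 2" using graph unfolding simple_graph_def by blast+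
  then show ?thesis by (cases "u = w") auto
qed

lemma edge_obtain:
  assumes "e \<in> E" obtains u w where "e = {u, w}" "u < w"
proof -
  have "card e = 2" using assms graph by (auto simp: simple_graph_def)
  then obtain u w where "e = {u, w}" "u \<noteq> w" by (auto simp: card_2_iff)
  then show ?thesis using that by (metis insert_commute nat_neq_iff)
qed

text \<open>The drawing together with \<open>g\<close> is itself an embedding of the larger graph.
  This is the form in which maximality is contradicted.\<close>

lemma planar_insert_edge:
  assumes uv: "u \<in> V" "v \<in> V" "u \<noteq> v" "{u, v} \<notin> E"
    and g: "arc g" "pathstart g = q u" "pathfinish g = q v"
    and gV: "path_image g \<inter> q ` V \<subseteq> {q u, q v}"
    and gE: "\<And>a b. {a, b} \<in> E \<Longrightarrow> path_image g \<inter> closed_segment (q a) (q b) \<subseteq> q ` ({u, v} \<inter> {a, b})"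
  shows "planar V (insert {u, v} E)"
proof -
  \<comment> \<open>An edge is an unordered set, so \<open>Min\<close> and \<open>Max\<close> orient
    its segment.\<close>
  define \<gamma> where "\<gamma> e = (if e = {u, v} then g else linepath (q (Min e)) (q (Max e)))" for e
  have \<gamma>E: "\<gamma> {a, b} = linepath (q a) (q b)" if "{a, b} \<in> E" "a < b" for a b
  proof -
    have "{a, b} \<noteq> {u, v}" using that uv by metis
    then show ?thesis using that by (simp add: \<gamma>_def)
  qed
  have \<gamma>g: "\<gamma> {u, v} = g" by (simp add: \<gamma>_def)
  have "simple_graph V (insert {u, v} E)"
    using graph uv by (auto simp: simple_graph_def)
  moreover have "planar_embedding V (insert {u, v} E) q \<gamma>"
    unfolding planar_embedding_def
  proof (intro conjI ballI impI)
    show "inj_on q V" by (rule inj)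
  next
    fix e assume "e \<in> insert {u, v} E"
    then consider "e = {u, v}" | "e \<in> E" by auto
    then have "arc (\<gamma> e) \<and> {pathstart (\<gamma> e), pathfinish (\<gamma> e)} = q ` e \<and>
              path_image (\<gamma> e) \<inter> q ` V = q ` e"
    proof cases
      case 1
      have "q u \<in> path_image g" "q v \<in> path_image g" 
        using g(2,3) pathstart_in_path_image[of g] pathfinish_in_path_image[of g] by auto
      then show ?thesis using g gV uv by (auto simp: 1 \<gamma>g)
    next
      case 2
      then obtain a b where e: "e = {a, b}" "a < b" by (rule edge_obtain)
      have ab: "a \<in> V" "b \<in> V" "a \<noteq> b" using edge_in[of a b] 2 e by auto
      then have "q a \<noteq> q b" using inj by (auto simp: inj_on_def)
      moreover have "closed_segment (q a) (q b) \<inter> q ` V = q ` e"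
        using vertex_edge[of _ a b] 2 ab by (auto simp: e)
      ultimately show ?thesis using \<gamma>E[of a b] 2 by (simp add: e)
    qed
    then show "arc (\<gamma> e)" "{pathstart (\<gamma> e), pathfinish (\<gamma> e)} = q ` e"
      "path_image (\<gamma> e) \<inter> q ` V = q ` e" by auto
  next
    fix e e' assume "e \<in> insert {u, v} E" "e' \<in> insert {u, v} E" "e \<noteq> e'"
    then consider "e = {u, v}" "e' \<in> E" | "e' = {u, v}" "e \<in> E" | "e \<in> E" "e' \<in> E" by auto
    then show "path_image (\<gamma> e) \<inter> path_image (\<gamma> e') \<subseteq> q ` (e \<inter> e')"
    proof cases
      case 1
      then obtain a b where e: "e' = {a, b}" "a < b" using edge_obtain by blast
      then show ?thesis using gE[of a b] 1 \<gamma>E[of a b] by (simp add: \<gamma>g)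
    next
      case 2
      then obtain a b where e: "e = {a, b}" "a < b" using edge_obtain by blast
      then show ?thesis using gE[of a b] 2 \<gamma>E[of a b] by (simp add: \<gamma>g Int_commute)
    next
      case 3
      obtain a b where e: "e = {a, b}" "a < b" using 3 edge_obtain by blast
      obtain c d where e': "e' = {c, d}" "c < d" using 3 edge_obtain by blast
      show ?thesis using edges_meet[of a b c d] 3 \<open>e \<noteq> e'\<close> \<gamma>E[of a b] \<gamma>E[of c d] e e' by simp
    qed
  qed
  ultimately show ?thesis by (auto simp: planar_def)
qed

end

section \<open>Extreme points and the outer face\<close>

text \<open>A step from \<open>x\<close> along the outward normal of a supporting hyperplane leaves
  \<open>S\<close> at once. A singleton is its own relative interior, so it is treated
  separately.\<close>

lemma extreme_point_exit:
  fixes x :: "'a::euclidean_space"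
  assumes "compact S" "convex S" "x extreme_point_of S"
  obtains y where "y \<notin> S" "closed_segment x y \<inter> S \<subseteq> {x}"
proof (cases "S = {x}")
  case True
  obtain b :: 'a where "b \<in> Basis" using nonempty_Basis by blast
  then have "x + b \<notin> S" by (auto simp: True)
  then show ?thesis using that[of "x + b"] True by auto
next
  case False
  have xS: "x \<in> S" using assms(3) by (simp add: extreme_point_of_def)
  obtain a where a: "a \<noteq> 0" "\<And>y. y \<in> closure S \<Longrightarrow> a \<bullet> x \<le> a \<bullet> y"
    using supporting_hyperplane_relative_frontier[OF assms(2) subsetD[OF closure_subset xS]
      extreme_point_not_in_REL_INTERIOR[OF assms(3) False]] by metis
  have *: "y = x" if y_seg: "y \<in> closed_segment x (x - a)" and yS: "y \<in> S" for y
  proof -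
    obtain t where t: "0 \<le> t" and "y = (1 - t) *\<^sub>R x + t *\<^sub>R (x - a)"
      using y_seg by (auto simp: in_segment)
    then have y: "y = x - t *\<^sub>R a" by (simp add: algebra_simps)
    have "a \<bullet> x \<le> a \<bullet> y" using a(2) subsetD[OF closure_subset yS] by blast
    then have "t * (a \<bullet> a) \<le> 0" by (simp add: y inner_diff_right)
    moreover have "a \<bullet> a > 0" using a(1) by simp
    ultimately have "t = 0" using t by (auto simp: mult_le_0_iff)
    then show ?thesis by (simp add: y)
  qed
  show ?thesis
  proof (rule that[of "x - a"])
    show "x - a \<notin> S" using *[of "x - a"] a(1) by auto
    show "closed_segment x (x - a) \<inter> S \<subseteq> {x}" using * by auto
  qed
qed

text \<open>Leave \<open>S\<close> at \<open>x\<close> and at \<open>y\<close> and join the two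
  exits in the complement, which is path-connected in dimension at least 2. Passing from a path to
  an arc only shrinks the image.\<close>

lemma extreme_points_outer_arc:
  fixes x y :: "'a::euclidean_space"
  assumes "2 \<le> DIM('a)" "compact S" "convex S" "x extreme_point_of S" "y extreme_point_of S" "x \<noteq> y"
  obtains g where "arc g" "pathstart g = x" "pathfinish g = y" "path_image g \<inter> S \<subseteq> {x, y}"
proof -
  obtain x' where x': "x' \<notin> S" "closed_segment x x' \<inter> S \<subseteq> {x}"
    using extreme_point_exit assms by blast
  obtain y' where y': "y' \<notin> S" "closed_segment y y' \<inter> S \<subseteq> {y}"
    using extreme_point_exit assms by blast
  have "path_connected (- S)"
    using assms by (intro path_connected_complement_bounded_convex compact_imp_bounded)
  then obtain h where h: "path h" "path_image h \<subseteq> - S" "pathstart h = x'" "pathfinish h = y'"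
    using x' y' unfolding path_connected_def by blast
  define f where "f = linepath x x' +++ (h +++ linepath y' y)"
  have "path f" "pathstart f = x" "pathfinish f = y" using h by (auto simp: f_def)
  then obtain g where "arc g" "path_image g \<subseteq> path_image f" "pathstart g = x" "pathfinish g = y"
    using path_contains_arc[of f x y] assms(6) by metis
  moreover have "path_image f \<inter> S \<subseteq> {x, y}"
    using h x' y' by (auto simp: f_def path_image_join closed_segment_commute[of y' y])
  ultimately show ?thesis using that[of g] by blast
qed

locale maximal_straight_drawing = straight_drawing +
  assumes maximal: "u \<in> V \<Longrightarrow> v \<in> V \<Longrightarrow> u \<noteq> v \<Longrightarrow> {u, v} \<notin> E \<Longrightarrow> \<not> planar V (insert {u, v} E)"
begin

lemma finite_V: "finite V" using graph by (simp add: simple_graph_def)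

lemma extreme_adjacent:
  assumes uv: "u \<in> V" "v \<in> V" "u \<noteq> v"
    and ext: "q u extreme_point_of (convex hull (q ` V))" "q v extreme_point_of (convex hull (q ` V))"
  shows "{u, v} \<in> E"
proof (rule ccontr)
  assume nE: "{u, v} \<notin> E"
  let ?H = "convex hull (q ` V)"
  have "q u \<noteq> q v" using uv inj by (auto simp: inj_on_def)
  moreover have "compact ?H" using finite_V by (simp add: finite_imp_compact_convex_hull)
  ultimately obtain g where g: "arc g" "pathstart g = q u" "pathfinish g = q v"
      "path_image g \<inter> ?H \<subseteq> {q u, q v}"
    using extreme_points_outer_arc[of ?H "q u" "q v"] ext by auto
  have VH: "q ` V \<subseteq> ?H" by (rule hull_subset)
  have "planar V (insert {u, v} E)"
  proof (rule planar_insert_edge[OF uv nE g(1-3)])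
    show "path_image g \<inter> q ` V \<subseteq> {q u, q v}" using g(4) VH by blast
    fix a b assume ab: "{a, b} \<in> E"
    have "closed_segment (q a) (q b) \<subseteq> ?H"
      using edge_in[OF ab] VH by (intro closed_segment_subset) auto
    \<comment> \<open>The arc meets the hull at most in \<open>q u\<close> and \<open>q v\<close>,
      and an edge through one of these points has that vertex as an end.\<close>
    then show "path_image g \<inter> closed_segment (q a) (q b) \<subseteq> q ` ({u, v} \<inter> {a, b})"
      using g(4) vertex_edge[OF uv(1) ab] vertex_edge[OF uv(2) ab] by blast
  qed
  then show False using maximal uv nE by blast
qed

text \<open>Radon's theorem splits four extreme points into two parts with intersecting hulls. Both
  parts must be pairs, so they are two disjoint crossing edges by
  \<open>extreme_adjacent\<close>.\<close>

lemma card_extreme_le_3: "card {x. x extreme_point_of (convex hull (q ` V))} \<le> 3"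
proof (rule ccontr)
  let ?H = "convex hull (q ` V)"
  let ?X = "{x. x extreme_point_of ?H}"
  assume "\<not> card ?X \<le> 3"
  then obtain T where T: "T \<subseteq> ?X" "card T = 4" 
    using obtain_subset_with_card_n[of 4 ?X] by force
  have finT: "finite T" using T(2) card.infinite by fastforce
  have TH: "T \<subseteq> ?H" using T by (auto simp: extreme_point_of_def)
  have "affine_dependent T"
    using T finT by (intro affine_dependent_biggerset) auto
  then obtain M P where MP: "M \<inter> P = {}" "M \<union> P = T" "convex hull M \<inter> convex hull P \<noteq> {}"
    using Radon_partition[OF finT] by blast
  \<comment> \<open>Removing an extreme point leaves the hull convex, so a single extreme point
    cannot lie in the hull of the others. The claim is applied to both orders of the parts.\<close>
  have big: "card M \<ge> 2" if "M \<inter> P = {}" "M \<union> P = T" "convex hull M \<inter> convex hull P \<noteq> {}" for M P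
  proof (rule ccontr)
    assume "\<not> card M \<ge> 2"
    have "finite M" using that finT by auto
    moreover have "M \<noteq> {}" using that by auto
    ultimately have "card M = 1" using \<open>\<not> card M \<ge> 2\<close> by (metis One_nat_def card_gt_0_iff less_2_cases linorder_not_less nat_neq_iff)
    then obtain x where x: "M = {x}" by (auto simp: card_1_singleton_iff)
    have "convex (?H - {x})" using T(1) that x by (auto simp: extreme_point_of_stillconvex)
    moreover have "P \<subseteq> ?H - {x}" using that TH x by auto
    ultimately have "convex hull P \<subseteq> ?H - {x}" by (simp add: hull_minimal)
    then show False using that x by auto
  qed
  have "card M \<ge> 2" using big[OF MP] .
  moreover have "card P \<ge> 2" using big[of P M] MP by (simp add: Int_commute Un_commute)
  moreover have "card M + card P = 4" using MP T finT
    by (metis card_Un_disjoint finite_Un)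
  ultimately have "card M = 2" "card P = 2" by auto
  then obtain x y z w where M: "M = {x, y}" "x \<noteq> y" and P: "P = {z, w}" "z \<noteq> w"
    by (auto simp: card_2_iff)
  have ex: "\<exists>v\<in>V. q v = t \<and> q v extreme_point_of ?H" if "t \<in> T" for t
    using that T extreme_point_of_convex_hull by fastforce
  obtain a where a: "a \<in> V" "q a = x" "q a extreme_point_of ?H" using ex[of x] M MP by auto
  obtain b where b: "b \<in> V" "q b = y" "q b extreme_point_of ?H" using ex[of y] M MP by auto
  obtain c where c: "c \<in> V" "q c = z" "q c extreme_point_of ?H" using ex[of z] P MP by auto
  obtain d where d: "d \<in> V" "q d = w" "q d extreme_point_of ?H" using ex[of w] P MP by auto
  have ab: "{a, b} \<in> E" using a b M by (intro extreme_adjacent) auto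
  have cd: "{c, d} \<in> E" using c d P by (intro extreme_adjacent) auto
  have dis: "{a, b} \<inter> {c, d} = {}" using MP M P a b c d by auto
  have "closed_segment (q a) (q b) \<inter> closed_segment (q c) (q d) \<subseteq> {}"
    using edges_meet[OF ab cd] dis by auto
  then show False using MP M P a b c d by (simp add: segment_convex_hull)
qed

text \<open>The extreme points span the hull by Krein-Milman. One of at least four vertices is not
  extreme; with fewer than three extreme points there would be no room for it, as it would coincide
  with a vertex or lie on an edge.\<close>

lemma outer_triangle:
  assumes "card V \<ge> 4"
  obtains a b c where "{a, b} \<in> E" "{b, c} \<in> E" "{c, a} \<in> E" "q ` V \<subseteq> convex hull {q a, q b, q c}"
proof -
  let ?H = "convex hull (q ` V)"
  define X where "X = {v \<in> V. q v extreme_point_of ?H}"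
  have XV: "X \<subseteq> V" by (auto simp: X_def)
  have finX: "finite X" using XV finite_V finite_subset by blast
  have qX: "q ` X = {x. x extreme_point_of ?H}"
    using extreme_point_of_convex_hull by (fastforce simp: X_def)
  have "card X = card (q ` X)" using inj XV by (metis card_image inj_on_subset)
  then have "card X \<le> 3" using card_extreme_le_3 qX by simp
  have HX: "?H = convex hull (q ` X)"
    using Krein_Milman_polytope[of "q ` V"] finite_V qX by simp
  have adj: "{u, v} \<in> E" if "u \<in> X" "v \<in> X" "u \<noteq> v" for u v
    using that extreme_adjacent by (auto simp: X_def)
  have sub: "q ` V \<subseteq> convex hull (q ` X)" using HX hull_subset[of "q ` V" convex] by simp
  have "\<not> V \<subseteq> X" using assms \<open>card X \<le> 3\<close> card_mono[OF finX, of V] by auto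
  then obtain v where v: "v \<in> V" "v \<notin> X" by blast
  consider "card X = 0" | "card X = 1" | "card X = 2" | "card X = 3" using \<open>card X \<le> 3\<close> by linarith
  then show ?thesis
  proof cases
    case 1
    then have "X = {}" using finX by simp
    then show ?thesis using sub v by auto
  next
    case 2
    then obtain a where "X = {a}" by (auto simp: card_1_singleton_iff)
    then have "q v = q a" "a \<in> V" using sub v XV by auto
    then show ?thesis using inj v \<open>X = {a}\<close> by (auto simp: inj_on_def)
  next
    case 3
    then obtain a b where X: "X = {a, b}" "a \<noteq> b" by (auto simp: card_2_iff)
    then have "q v \<in> closed_segment (q a) (q b)" using sub v by (auto simp: segment_convex_hull)
    then show ?thesis using vertex_edge[OF v(1) adj[of a b]] v X by auto
  next
    case 4
    then obtain a b c where X: "X = {a, b, c}" "a \<noteq> b" "b \<noteq> c" "a \<noteq> c" by (auto simp: card_3_iff)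
    then show ?thesis using that[of a b c] adj sub by auto
  qed
qed

end

section \<open>Hyperbolic area\<close>

text \<open>
  In the coordinates \<open>x\<close> and \<open>w = 1 / y\<close> the hyperbolic area form \<open>dx dy / y\<^sup>2\<close> is Lebesgue measure.
\<close>

definition pt :: "real \<Rightarrow> real \<Rightarrow> complex" where
  "pt x w = Complex x (x\<^sup>2 + (1 / w)\<^sup>2)"

lemma pt_dom: "w > 0 \<Longrightarrow> pt x w \<in> para_dom"
  by (simp add: pt_def para_dom_def)

lemma height_pt: "w > 0 \<Longrightarrow> height (pt x w) = 1 / w"
  by (simp add: pt_def height_def)

text \<open>In the half-plane the segment is an arc of the circle with centre \<open>c\<close> on
  the real axis and radius \<open>\<rho>\<close>. The region above it has slices
  \<open>0 < w \<le> 1 / sqrt (\<rho>^2 - (x - c)^2)\<close>, and the antiderivative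
  \<open>arcsin\<close> varies by at most \<open>pi\<close>.\<close>

lemma area_above_rising_segment:
  assumes ab: "a \<in> para_dom" "b \<in> para_dom" and lt: "Re a < Re b"
  obtains g :: "real \<Rightarrow> ennreal" where "g \<in> borel_measurable lborel" "(\<integral>\<^sup>+x. g x \<partial>lborel) \<le> ennreal pi"
    "\<And>x w u. w > 0 \<Longrightarrow> Complex x u \<in> closed_segment a b \<Longrightarrow> u \<le> x\<^sup>2 + (1 / w)\<^sup>2 \<Longrightarrow> ennreal w \<le> g x"
proof -
  define m where "m = (Im b - Im a) / (Re b - Re a)"
  define l where "l x = Im a + m * (x - Re a)" for x
  have seg: "Re z \<in> {Re a..Re b} \<and> Im z = l (Re z)" if "z \<in> closed_segment a b" for z
  proof -
    obtain t where t: "0 \<le> t" "t \<le> 1" "z = (1 - t) *\<^sub>R a + t *\<^sub>R b"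
      using \<open>z \<in> closed_segment a b\<close> by (auto simp: in_segment)
    have R: "Re z = Re a + t * (Re b - Re a)" and I: "Im z = Im a + t * (Im b - Im a)"
      unfolding t(3) by (simp_all add: algebra_simps)
    have "0 \<le> t * (Re b - Re a)" "t * (Re b - Re a) \<le> Re b - Re a"
      using t lt by (auto intro!: mult_left_le_one_le)
    then have "Re z \<in> {Re a..Re b}" unfolding R by auto
    moreover have "Im z = l (Re z)" using lt by (simp add: R I l_def m_def)
    ultimately show ?thesis by blast
  qed
  have dom: "x\<^sup>2 < l x" if "x \<in> {Re a..Re b}" for x
  proof -
    define t where "t = (x - Re a) / (Re b - Re a)"
    have t: "0 \<le> t" "t \<le> 1" using that lt by (auto simp: t_def)
    define z where "z = (1 - t) *\<^sub>R a + t *\<^sub>R b"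
    have z: "z \<in> closed_segment a b" using t by (auto simp: in_segment z_def)
    have "Re z = Re a + t * (Re b - Re a)" by (simp add: z_def algebra_simps)
    then have "Re z = x" using lt by (simp add: t_def)
    then show ?thesis using pdist_segment(1)[OF ab z] seg[OF z] by (simp add: para_dom_def)
  qed
  \<comment> \<open>Completing the square in \<open>l x - x\<^sup>2\<close>, where \<open>l\<close>
    has slope \<open>m\<close>.\<close>
  define c where "c = m / 2"
  define R where "R = l (Re a) - (Re a)\<^sup>2 + (Re a - c)\<^sup>2"
  have R: "R > 0" using dom[of "Re a"] lt by (simp add: R_def add_pos_nonneg)
  have f: "l x - x\<^sup>2 = R - (x - c)\<^sup>2" for x
    by (simp add: R_def l_def c_def power2_eq_square field_simps)
  define \<rho> where "\<rho> = sqrt R"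
  have \<rho>: "\<rho> > 0" "\<rho>\<^sup>2 = R" using R by (auto simp: \<rho>_def)
  have deriv: "((\<lambda>x. arcsin ((x - c) / \<rho>)) has_real_derivative 1 / sqrt (l x - x\<^sup>2)) (at x)"
    if "x \<in> {Re a..Re b}" for x
  proof -
    have pos: "R - (x - c)\<^sup>2 > 0" using dom[OF that] f[of x] by simp
    then have "((x - c) / \<rho>)\<^sup>2 < 1" using R by (simp add: power_divide \<rho>(2))
    then have "\<bar>(x - c) / \<rho>\<bar> < 1" by (simp only: abs_square_less_1)
    then have b: "-1 < (x - c) / \<rho>" "(x - c) / \<rho> < 1" by linarith+
    have "sqrt (l x - x\<^sup>2) = sqrt (1 - ((x - c) / \<rho>)\<^sup>2) * \<rho>"
    proof -
      have "l x - x\<^sup>2 = (1 - ((x - c) / \<rho>)\<^sup>2) * \<rho>\<^sup>2"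
        unfolding f power_divide \<rho>(2) using R by (simp add: left_diff_distrib)
      then show ?thesis using \<rho>(1) by (simp add: real_sqrt_mult)
    qed
    then show ?thesis using b \<rho>(1)
      by (auto intro!: derivative_eq_intros simp: divide_inverse)
  qed
  define g where "g x = ennreal (1 / sqrt (l x - x\<^sup>2)) * indicator {Re a..Re b} x" for x
  have "((\<lambda>x. 1 / sqrt (l x - x\<^sup>2)) has_integral
      (arcsin ((Re b - c) / \<rho>) - arcsin ((Re a - c) / \<rho>))) {Re a..Re b}"
    using lt deriv
    by (intro fundamental_theorem_of_calculus)
       (auto simp: has_real_derivative_iff_has_vector_derivative[symmetric] intro: has_field_derivative_at_within)
  then have int: "(\<integral>\<^sup>+x. g x \<partial>lborel) = ennreal (arcsin ((Re b - c) / \<rho>) - arcsin ((Re a - c) / \<rho>))"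
    unfolding g_def using dom by (intro nn_integral_has_integral_lebesgue') (auto intro: less_imp_le)
  have bnd: "((x - c) / \<rho>)\<^sup>2 \<le> 1" if "x \<in> {Re a..Re b}" for x
    using dom[OF that] f[of x] R by (simp add: power_divide \<rho>(2))
  have "\<bar>(Re b - c) / \<rho>\<bar> \<le> 1" "\<bar>(Re a - c) / \<rho>\<bar> \<le> 1"
    using bnd[of "Re b"] bnd[of "Re a"] lt by (auto simp: abs_square_le_1)
  then have "- 1 \<le> (Re b - c) / \<rho>" "(Re b - c) / \<rho> \<le> 1" "- 1 \<le> (Re a - c) / \<rho>" "(Re a - c) / \<rho> \<le> 1"
    by linarith+
  then have "arcsin ((Re b - c) / \<rho>) \<le> pi / 2" "- (pi / 2) \<le> arcsin ((Re a - c) / \<rho>)"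
    by (blast intro: arcsin_ubound arcsin_lbound)+
  then have le: "(\<integral>\<^sup>+x. g x \<partial>lborel) \<le> ennreal pi"
    unfolding int by (intro ennreal_leI) linarith
  have meas: "g \<in> borel_measurable lborel" unfolding g_def l_def by measurable
  show ?thesis
  proof (rule that[OF meas le])
    fix x w u :: real assume w: "w > 0" and s: "Complex x u \<in> closed_segment a b" and u: "u \<le> x\<^sup>2 + (1 / w)\<^sup>2"
    have x: "x \<in> {Re a..Re b}" and ul: "u = l x" using seg[OF s] by auto
    have "l x - x\<^sup>2 \<le> (1 / w)\<^sup>2" using u ul by simp
    then have "sqrt (l x - x\<^sup>2) \<le> 1 / w" using w by (simp add: real_le_lsqrt)
    then have "w \<le> 1 / sqrt (l x - x\<^sup>2)" using w dom[OF x] by (simp add: field_simps)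
    then show "ennreal w \<le> g x" using x by (simp add: g_def ennreal_leI)
  qed
qed

text \<open>A vertical segment carries the junk bound \<open>\<infinity>\<close> on a null set.\<close>

lemma area_above_segment:
  assumes ab: "a \<in> para_dom" "b \<in> para_dom"
  obtains g :: "real \<Rightarrow> ennreal" where "g \<in> borel_measurable lborel" "(\<integral>\<^sup>+x. g x \<partial>lborel) \<le> ennreal pi"
    "\<And>x w u. w > 0 \<Longrightarrow> Complex x u \<in> closed_segment a b \<Longrightarrow> u \<le> x\<^sup>2 + (1 / w)\<^sup>2 \<Longrightarrow> ennreal w \<le> g x"
proof -
  consider "Re a < Re b" | "Re b < Re a" | "Re a = Re b" by linarith
  then show ?thesis
  proof cases
    case 1
    show ?thesis by (rule area_above_rising_segment[OF ab 1]) (rule that)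
  next
    case 2
    show ?thesis by (rule area_above_rising_segment[OF ab(2,1) 2]) (rule that, simp_all add: closed_segment_commute)
  next
    case 3
    show ?thesis
    proof (rule that[of "\<lambda>x. top * indicator {Re a} x"])
      show "(\<integral>\<^sup>+x. top * indicator {Re a} x \<partial>lborel) \<le> ennreal pi"
        by (simp add: nn_integral_cmult_indicator)
      fix x w u :: real assume "Complex x u \<in> closed_segment a b"
      then obtain t where "Complex x u = (1 - t) *\<^sub>R a + t *\<^sub>R b" by (auto simp: in_segment)
      then have "x = (1 - t) * Re a + t * Re b" by (metis complex.sel(1) plus_complex.sel(1) scaleR_complex.sel(1))
      then have "x = Re a" using 3 by (simp add: algebra_simps)
      then show "ennreal w \<le> top * indicator {Re a} x" by simp
    qed simp
  qed
qed

text \<open>The vertical ray downwards is connected and leaves the bounded triangle, so it meets the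
  frontier, which consists of the sides.\<close>

lemma triangle_below:
  assumes "Complex x u \<in> convex hull {a, b, c}"
  obtains u' where "u' \<le> u"
    "Complex x u' \<in> closed_segment a b \<union> closed_segment b c \<union> closed_segment c a"
proof -
  let ?T = "convex hull {a, b, c}"
  define L where "L = {z. Re z = x \<and> Im z \<le> u}"
  have "convex L"
    unfolding L_def convex_alt
  proof (intro ballI allI impI, safe)
    fix z y :: complex and t :: real
    assume *: "Im z \<le> u" "Im y \<le> u" "0 \<le> t" "t \<le> 1" "x = Re z" "Re y = Re z"
    show "Re ((1 - t) *\<^sub>R z + t *\<^sub>R y) = Re z" using * by (simp add: algebra_simps)
    show "Im ((1 - t) *\<^sub>R z + t *\<^sub>R y) \<le> u"
      using * convex_bound_le[of "Im z" u "Im y" "1 - t" t] by simp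
  qed
  then have "connected L" by (rule convex_connected)
  have "bounded ?T" by (simp add: bounded_convex_hull)
  then obtain B where B: "\<And>z. z \<in> ?T \<Longrightarrow> cmod z \<le> B" by (auto simp: bounded_iff)
  \<comment> \<open>The minimum keeps \<open>y\<close> on the ray while its modulus exceeds
    \<open>B\<close>.\<close>
  define y where "y = Complex x (min u (- \<bar>B\<bar> - 1))"
  have "\<bar>Im y\<bar> > B" by (simp add: y_def)
  then have "y \<notin> ?T" using B[of y] abs_Im_le_cmod[of y] by linarith
  moreover have "y \<in> L" by (simp add: L_def y_def)
  moreover have "Complex x u \<in> L" by (simp add: L_def)
  ultimately have "L \<inter> frontier ?T \<noteq> {}"
    using connected_Int_frontier[OF \<open>connected L\<close>, of ?T] assms by blast
  then obtain z where z: "z \<in> L" "z \<in> frontier ?T" by blast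
  show ?thesis
  proof (rule that[of "Im z"])
    have "Complex x (Im z) = z" using z by (simp add: L_def complex_eq_iff)
    then show "Complex x (Im z) \<in> closed_segment a b \<union> closed_segment b c \<union> closed_segment c a"
      using z(2) frontier_of_triangle[of a b c] by simp
  qed (use z in \<open>simp add: L_def\<close>)
qed

lemma emeasure_pos_bounded_le: "emeasure lborel {w::real. 0 < w \<and> ennreal w \<le> M} \<le> M"
proof (cases M)
  case (real r)
  have "{w::real. 0 < w \<and> ennreal w \<le> M} \<subseteq> {0..r}" using real by auto
  then have "emeasure lborel {w::real. 0 < w \<and> ennreal w \<le> M} \<le> emeasure lborel {0..r}"
    by (intro emeasure_mono) auto
  then show ?thesis using real by simp
qed simp

text \<open>Every point of the triangle lies above some side, so each slice is bounded by the sum of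
  the three side bounds, and integration gives \<open>pi\<close> per side. This is cruder than
  Gauss-Bonnet.\<close>

lemma triangle_area_le:
  assumes abc: "a \<in> para_dom" "b \<in> para_dom" "c \<in> para_dom"
    and U: "U \<in> sets (lborel \<Otimes>\<^sub>M lborel)"
    and UT: "\<And>x w. (x, w) \<in> U \<Longrightarrow> w > 0 \<and> pt x w \<in> convex hull {a, b, c}"
  shows "emeasure (lborel \<Otimes>\<^sub>M lborel) U \<le> ennreal (3 * pi)"
proof -
  obtain f :: "real \<Rightarrow> ennreal" where f: "f \<in> borel_measurable lborel" "(\<integral>\<^sup>+x. f x \<partial>lborel) \<le> ennreal pi"
    "\<And>x w u. w > 0 \<Longrightarrow> Complex x u \<in> closed_segment a b \<Longrightarrow> u \<le> x\<^sup>2 + (1 / w)\<^sup>2 \<Longrightarrow> ennreal w \<le> f x"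
    by (rule area_above_segment[OF abc(1,2)]) (rule that)
  obtain g :: "real \<Rightarrow> ennreal" where g: "g \<in> borel_measurable lborel" "(\<integral>\<^sup>+x. g x \<partial>lborel) \<le> ennreal pi"
    "\<And>x w u. w > 0 \<Longrightarrow> Complex x u \<in> closed_segment b c \<Longrightarrow> u \<le> x\<^sup>2 + (1 / w)\<^sup>2 \<Longrightarrow> ennreal w \<le> g x"
    by (rule area_above_segment[OF abc(2,3)]) (rule that)
  obtain h :: "real \<Rightarrow> ennreal" where h: "h \<in> borel_measurable lborel" "(\<integral>\<^sup>+x. h x \<partial>lborel) \<le> ennreal pi"
    "\<And>x w u. w > 0 \<Longrightarrow> Complex x u \<in> closed_segment c a \<Longrightarrow> u \<le> x\<^sup>2 + (1 / w)\<^sup>2 \<Longrightarrow> ennreal w \<le> h x"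
    by (rule area_above_segment[OF abc(3,1)]) (rule that)
  note [measurable] = f(1) g(1) h(1)
  have slice: "emeasure lborel (Pair x -` U) \<le> f x + g x + h x" for x
  proof -
    have "Pair x -` U \<subseteq> {w. 0 < w \<and> ennreal w \<le> f x + g x + h x}"
    proof
      fix w assume "w \<in> Pair x -` U"
      then have w: "w > 0" and T: "pt x w \<in> convex hull {a, b, c}" using UT by auto
      obtain u where u: "u \<le> x\<^sup>2 + (1 / w)\<^sup>2"
        "Complex x u \<in> closed_segment a b \<union> closed_segment b c \<union> closed_segment c a"
        using triangle_below[OF T[unfolded pt_def]] .
      then consider "ennreal w \<le> f x" | "ennreal w \<le> g x" | "ennreal w \<le> h x"
        using f(3) g(3) h(3) w by blast
      then have "ennreal w \<le> f x + g x + h x"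
        by cases (simp_all add: add.assoc add_increasing add_increasing2)
      then show "w \<in> {w. 0 < w \<and> ennreal w \<le> f x + g x + h x}" using w by simp
    qed
    then have "emeasure lborel (Pair x -` U) \<le> emeasure lborel {w. 0 < w \<and> ennreal w \<le> f x + g x + h x}"
      by (rule emeasure_mono) measurable
    then show ?thesis using emeasure_pos_bounded_le order.trans by blast
  qed
  have "emeasure (lborel \<Otimes>\<^sub>M lborel) U = (\<integral>\<^sup>+x. emeasure lborel (Pair x -` U) \<partial>lborel)"
    by (rule lborel.emeasure_pair_measure_alt[OF U])
  also have "\<dots> \<le> (\<integral>\<^sup>+x. f x + g x + h x \<partial>lborel)"
    by (intro nn_integral_mono slice)
  also have "\<dots> = (\<integral>\<^sup>+x. f x \<partial>lborel) + (\<integral>\<^sup>+x. g x \<partial>lborel) + (\<integral>\<^sup>+x. h x \<partial>lborel)"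
    by (simp add: nn_integral_add)
  also have "\<dots> \<le> ennreal pi + ennreal pi + ennreal pi"
    using f(2) g(2) h(2) by (intro add_mono)
  also have "\<dots> = ennreal (3 * pi)" by (simp flip: ennreal_plus)
  finally show ?thesis .
qed

text \<open>
  The image of one fixed box around \<open>(0, 1)\<close> under the isometry \<open>x + iy \<mapsto> Re c + height c * (x + iy)\<close>, which
  is linear of determinant 1 in the coordinates \<open>(x, w)\<close> up to a translation.
\<close>

definition hbox :: "real \<Rightarrow> real \<Rightarrow> complex \<Rightarrow> (real \<times> real) set" where
  "hbox \<alpha> \<beta> c = {Re c - \<alpha> * height c..Re c + \<alpha> * height c} \<times> {1 / height c..(1 + \<beta>) / height c}"

text \<open>The factors \<open>height c\<close> and \<open>1 / height c\<close> of the two side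
  lengths cancel.\<close>

lemma emeasure_hbox:
  assumes "c \<in> para_dom" "\<alpha> \<ge> 0" "\<beta> \<ge> 0"
  shows "emeasure (lborel \<Otimes>\<^sub>M lborel) (hbox \<alpha> \<beta> c) = ennreal (2 * \<alpha> * \<beta>)"
proof -
  have h: "height c > 0" using assms by (simp add: height_pos)
  have "emeasure (lborel \<Otimes>\<^sub>M lborel) (hbox \<alpha> \<beta> c) = ennreal (2 * \<alpha> * height c) * ennreal (\<beta> / height c)"
    unfolding hbox_def using h assms
    by (subst lborel.emeasure_pair_measure_Times) (auto simp: field_simps)
  also have "\<dots> = ennreal (2 * \<alpha> * \<beta>)" using h assms by (simp flip: ennreal_mult)
  finally show ?thesis .
qed

text \<open>With \<open>w = (1 + s) / height c\<close> the formula \<open>lform_alt\<close> bounds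
  the hyperbolic cosine of the distance by
  \<open>1 + ((1 + \<beta>) \<alpha>^2 + \<beta>^2) / 2\<close>, which is compared with
  \<open>cosh (2 * r) = 1 + 2 (sinh r)^2\<close> and \<open>r \<le> sinh r\<close>.\<close>

lemma hbox_dist:
  assumes c: "c \<in> para_dom" and \<alpha>: "\<alpha> \<ge> 0" and \<beta>: "\<beta> \<ge> 0"
    and small: "(1 + \<beta>) * \<alpha>\<^sup>2 + \<beta>\<^sup>2 < 4 * r\<^sup>2" and r: "r > 0" 
    and xw: "(x, w) \<in> hbox \<alpha> \<beta> c"
  shows "w > 0" "pdist c (pt x w) < 2 * r"
proof -
  define h where "h = height c"
  have h: "h > 0" using c by (simp add: h_def height_pos)
  define s where "s = w * h - 1"
  have ws: "w = (1 + s) / h" using h by (simp add: s_def)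
  have "1 / h \<le> w" "w \<le> (1 + \<beta>) / h" using xw by (auto simp: hbox_def h_def)
  then have s: "0 \<le> s" "s \<le> \<beta>" using h by (auto simp: s_def field_simps)
  show w: "w > 0" using ws s h by simp
  have "\<bar>Re c - x\<bar> \<le> \<alpha> * h" using xw by (auto simp: hbox_def h_def)
  then have xx: "(Re c - x)\<^sup>2 \<le> (\<alpha> * h)\<^sup>2" by (metis abs_ge_zero power2_abs power_mono)
  have "lform c (pt x w) = 1 + ((Re c - x)\<^sup>2 + (h - 1 / w)\<^sup>2) / (2 * h * (1 / w))"
    using lform_alt[OF c pt_dom[OF w, of x]] by (simp add: height_pt[OF w] h_def) (simp add: pt_def)
  also have "\<dots> = 1 + ((Re c - x)\<^sup>2 / h\<^sup>2 * (1 + s) + s\<^sup>2 / (1 + s)) / 2"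
  proof -
    have *: "(D + (h * s / k)\<^sup>2) / (2 * h * (h / k)) = (D / h\<^sup>2 * k + s\<^sup>2 / k) / 2" if "k > 0" for D k
      using that h by (simp add: field_simps power2_eq_square)
    have "h - 1 / w = h * s / (1 + s)" "1 / w = h / (1 + s)" using s h by (simp_all add: ws field_simps)
    then show ?thesis using *[of "1 + s"] s by simp
  qed
  also have "\<dots> \<le> 1 + (\<alpha>\<^sup>2 * (1 + \<beta>) + \<beta>\<^sup>2) / 2"
  proof -
    have "(Re c - x)\<^sup>2 / h\<^sup>2 \<le> \<alpha>\<^sup>2" using xx h by (simp add: field_simps)
    then have "(Re c - x)\<^sup>2 / h\<^sup>2 * (1 + s) \<le> \<alpha>\<^sup>2 * (1 + \<beta>)" using s by (intro mult_mono) auto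
    moreover have "s\<^sup>2 / (1 + s) \<le> s\<^sup>2 / 1" using s by (intro divide_left_mono) auto
    moreover have "s\<^sup>2 \<le> \<beta>\<^sup>2" using s by (intro power_mono) auto
    ultimately show ?thesis unfolding div_by_1 by (intro add_left_mono divide_right_mono) linarith+
  qed
  also have "\<dots> < 1 + 2 * r\<^sup>2" using small by (simp add: algebra_simps)
  also have "\<dots> \<le> 1 + 2 * (sinh r)\<^sup>2"
  proof -
    have "r \<le> sinh r" using real_le_x_sinh[of r] r by (simp add: sinh_field_def exp_minus)
    then show ?thesis using r by (simp add: power_mono)
  qed
  also have "\<dots> = cosh (2 * r)" using cosh_double[of r] by (simp add: cosh_square_eq)
  finally have "cosh (pdist c (pt x w)) < cosh (2 * r)" by (simp add: cosh_pdist c pt_dom w)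
  then show "pdist c (pt x w) < 2 * r"
    using r pdist_nonneg[OF c pt_dom[OF w]] by (simp add: cosh_real_nonneg_less_iff)
qed

section \<open>Packing the outer triangle\<close>

text \<open>The assumption \<open>sep\<close> is the bound \<open>\<delta>\<close> on the resolution
  in pointwise form, free of infima.\<close>

locale separated_drawing = maximal_straight_drawing +
  fixes \<delta> :: real
  assumes \<delta>: "\<delta> > 0"
    and dom: "v \<in> V \<Longrightarrow> q v \<in> para_dom"
    and sep: "v \<in> V \<Longrightarrow> {u, w} \<in> E \<Longrightarrow> v \<notin> {u, w} \<Longrightarrow> y \<in> closed_segment (q u) (q w) \<Longrightarrow> \<delta> \<le> pdist (q v) y"
begin

text \<open>
  Any edge meeting a segment shorter than \<open>\<delta>\<close> contains both its ends. Other vertices may lie on the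
  segment, hence the detour through the one nearest to \<open>u\<close>.
\<close>

lemma close_adjacent:
  assumes uv: "u \<in> V" "v \<in> V" "u \<noteq> v" and close: "pdist (q u) (q v) < \<delta>"
  shows "{u, v} \<in> E"
proof -
  define N where "N = {x \<in> V - {u}. q x \<in> closed_segment (q u) (q v)}"
  have "finite N" "v \<in> N" using finite_V uv by (auto simp: N_def)
  \<comment> \<open>Nearest in the Euclidean distance, which is additive along the segment; hence no
    vertex lies strictly between \<open>q u\<close> and \<open>q x\<close>.\<close>
  then obtain x where x: "x \<in> N" and xmin: "\<And>w. w \<in> N \<Longrightarrow> dist (q u) (q x) \<le> dist (q u) (q w)"
    using ex_is_arg_min_if_finite[of N "\<lambda>x. dist (q u) (q x)"] 
    by (auto simp: is_arg_min_linorder)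
  have xV: "x \<in> V" "x \<noteq> u" and xs: "q x \<in> closed_segment (q u) (q v)" using x by (auto simp: N_def)
  have sub: "closed_segment (q u) (q x) \<subseteq> closed_segment (q u) (q v)"
    using xs by (simp add: subset_closed_segment)
  have ux: "pdist (q u) (q x) < \<delta>"
    using pdist_segment_le(1)[OF dom[OF uv(1)] dom[OF uv(2)] xs] close by simp
  have "{u, x} \<in> E"
  proof (rule ccontr)
    assume nE: "{u, x} \<notin> E"
    have "planar V (insert {u, x} E)"
    proof (rule planar_insert_edge[OF uv(1) xV(1) xV(2)[symmetric] nE, of "linepath (q u) (q x)"])
      have "q u \<noteq> q x" using inj uv xV by (auto simp: inj_on_def)
      then show "arc (linepath (q u) (q x))" by (rule arc_linepath)
      show "path_image (linepath (q u) (q x)) \<inter> q ` V \<subseteq> {q u, q x}"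
      proof
        fix y assume "y \<in> path_image (linepath (q u) (q x)) \<inter> q ` V"
        then obtain w where w: "w \<in> V" "y = q w" "q w \<in> closed_segment (q u) (q x)" by auto
        show "y \<in> {q u, q x}"
        proof (cases "w = u")
          case False
          then have "w \<in> N" using w sub by (auto simp: N_def)
          then have "dist (q u) (q x) \<le> dist (q u) (q w)" by (rule xmin)
          moreover have "dist (q u) (q x) = dist (q u) (q w) + dist (q w) (q x)"
            using w(3) between_mem_segment[of "q u" "q x" "q w"] by (simp add: between)
          ultimately have "q w = q x" by simp
          then show ?thesis using w by simp
        qed (use w in simp)
      qed
      fix a b assume ab: "{a, b} \<in> E"
      have False if y: "y \<in> closed_segment (q u) (q x)" "y \<in> closed_segment (q a) (q b)" for y
      proof -
        have le: "pdist (q u) y < \<delta>" "pdist (q x) y < \<delta>"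
          using pdist_segment_le[OF dom[OF uv(1)] dom[OF xV(1)] y(1)] ux by auto
        have "u \<in> {a, b}" using sep[OF uv(1) ab _ y(2)] le by force
        moreover have "x \<in> {a, b}" using sep[OF xV(1) ab _ y(2)] le by force
        ultimately have "{a, b} = {u, x}" using xV by auto
        then show False using nE ab by simp
      qed
      then show "path_image (linepath (q u) (q x)) \<inter> closed_segment (q a) (q b) \<subseteq> q ` ({u, x} \<inter> {a, b})"
        by auto
    qed auto
    then show False using maximal uv xV nE by blast
  qed
  \<comment> \<open>Otherwise \<open>q u\<close>, an end of the edge \<open>{u, x}\<close>, would be
    at distance at least \<open>\<delta>\<close> from \<open>q v\<close>.\<close>
  moreover have "x = v"
  proof (rule ccontr)
    assume "x \<noteq> v"
    then have "\<delta> \<le> pdist (q v) (q u)" using sep[OF uv(2) calculation, of "q u"] uv by auto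
    then show False using close by (simp add: pdist_commute)
  qed
  ultimately show ?thesis by simp
qed

text \<open>Closeness is a matching: \<open>{u, v}\<close> is an edge through \<open>q u\<close>, so
  any third vertex keeps distance \<open>\<delta>\<close> from \<open>q u\<close>.\<close>

lemma close_unique:
  assumes "u \<in> V" "v \<in> V" "w \<in> V" "u \<noteq> v" "u \<noteq> w" "pdist (q u) (q v) < \<delta>" "pdist (q u) (q w) < \<delta>"
  shows "v = w"
proof (rule ccontr)
  assume "v \<noteq> w"
  have "{u, v} \<in> E" using assms by (intro close_adjacent)
  then have "\<delta> \<le> pdist (q w) (q u)" using sep[OF assms(3), of u v "q u"] \<open>v \<noteq> w\<close> assms by auto
  then show False using assms by (simp add: pdist_commute)
qed

text \<open>From each close pair in \<open>I\<close> the set \<open>S\<close> keeps the vertex with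
  the smaller label, and it keeps every unpaired vertex. The removed vertices inject into
  \<open>S\<close> through their partners \<open>\<phi>\<close>.\<close>

lemma separated_half:
  assumes "I \<subseteq> V"
  obtains S where "S \<subseteq> I" "card I \<le> 2 * card S"
    "\<And>u v. u \<in> S \<Longrightarrow> v \<in> S \<Longrightarrow> u \<noteq> v \<Longrightarrow> \<delta> \<le> pdist (q u) (q v)"
proof -
  define S where "S = {v \<in> I. \<forall>w\<in>I. pdist (q v) (q w) < \<delta> \<longrightarrow> v \<le> w}"
  have finI: "finite I" using assms finite_V finite_subset by blast
  have finS: "finite S" using finI by (simp add: S_def)
  define \<phi> where "\<phi> v = (SOME w. w \<in> I \<and> pdist (q v) (q w) < \<delta> \<and> w < v)" for v
  have \<phi>: "\<phi> v \<in> I \<and> pdist (q v) (q (\<phi> v)) < \<delta> \<and> \<phi> v < v" if "v \<in> I - S" for v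
  proof -
    have "\<exists>w. w \<in> I \<and> pdist (q v) (q w) < \<delta> \<and> w < v" using that by (auto simp: S_def)
    then show ?thesis unfolding \<phi>_def by (rule someI_ex)
  qed
  have uniq: "v = w" if "u \<in> I" "v \<in> I" "w \<in> I" "u \<noteq> v" "u \<noteq> w" "pdist (q u) (q v) < \<delta>" "pdist (q u) (q w) < \<delta>" for u v w
    using that assms by (intro close_unique[of u v w]) auto
  have "\<phi> ` (I - S) \<subseteq> S"
  proof
    fix w assume "w \<in> \<phi> ` (I - S)"
    then obtain v where v: "v \<in> I - S" "w = \<phi> v" by auto
    note * = \<phi>[OF v(1), folded v(2)]
    have "w \<le> t" if "t \<in> I" "pdist (q w) (q t) < \<delta>" for t
    proof (cases "t = w")
      case False
      then have "t = v" using uniq[of w t v] that * v by (auto simp: pdist_commute)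
      then show ?thesis using * by simp
    qed simp
    then show "w \<in> S" using * by (simp add: S_def)
  qed
  moreover have "inj_on \<phi> (I - S)"
  proof (rule inj_onI)
    fix v v' assume v: "v \<in> I - S" "v' \<in> I - S" "\<phi> v = \<phi> v'"
    show "v = v'"
      using uniq[of "\<phi> v" v v'] \<phi>[OF v(1)] \<phi>[OF v(2)] v by (auto simp: pdist_commute)
  qed
  ultimately have "card (I - S) \<le> card S" using finS by (intro card_inj_on_le)
  moreover have "S \<subseteq> I" by (auto simp: S_def)
  ultimately have "card I \<le> 2 * card S" using finI finS card_mono by (simp add: card_Diff_subset)
  moreover have "\<delta> \<le> pdist (q u) (q v)" if "u \<in> S" "v \<in> S" "u \<noteq> v" for u v
    using that by (force simp: S_def pdist_commute not_less)
  ultimately show ?thesis using that \<open>S \<subseteq> I\<close> by blast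
qed

text \<open>A segment from \<open>q v\<close> to a point outside crosses a side. That side is an
  edge not incident to \<open>v\<close>, so the crossing is already at distance
  \<open>\<delta>\<close> or more.\<close>

lemma disc_in_triangle:
  assumes tri: "{a, b} \<in> E" "{b, c} \<in> E" "{c, a} \<in> E" "q ` V \<subseteq> convex hull {q a, q b, q c}"
    and v: "v \<in> V - {a, b, c}" and y: "y \<in> para_dom" "pdist (q v) y < \<delta>"
  shows "y \<in> convex hull {q a, q b, q c}"
proof (rule ccontr)
  let ?T = "convex hull {q a, q b, q c}"
  assume "y \<notin> ?T"
  have "closed_segment (q v) y \<inter> ?T \<noteq> {}" using tri(4) v by auto
  moreover have "closed_segment (q v) y - ?T \<noteq> {}" using \<open>y \<notin> ?T\<close> by auto
  ultimately have "closed_segment (q v) y \<inter> frontier ?T \<noteq> {}"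
    by (intro connected_Int_frontier) auto
  then obtain z where z: "z \<in> closed_segment (q v) y"
      "z \<in> closed_segment (q a) (q b) \<union> closed_segment (q b) (q c) \<union> closed_segment (q c) (q a)"
    using frontier_of_triangle[of "q a" "q b" "q c"] by auto
  have vV: "v \<in> V" using v by simp
  have "\<delta> \<le> pdist (q v) z"
    using z(2) sep[OF vV tri(1)] sep[OF vV tri(2)] sep[OF vV tri(3)] v by blast
  moreover have "pdist (q v) z \<le> pdist (q v) y"
    by (rule pdist_segment_le(1)[OF dom[OF vV] y(1) z(1)])
  ultimately show False using y(2) by simp
qed

lemma area_bound:
  assumes "card V \<ge> 4"
  shows "real (card V) * \<delta>\<^sup>2 \<le> 48 * pi * sqrt (8 + 2 * \<delta>)"
proof -
  obtain a b c where tri: "{a, b} \<in> E" "{b, c} \<in> E" "{c, a} \<in> E" "q ` V \<subseteq> convex hull {q a, q b, q c}"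
    using outer_triangle[OF assms] .
  have abc: "a \<in> V" "b \<in> V" "c \<in> V" using edge_in[OF tri(1)] edge_in[OF tri(2)] by auto
  define I where "I = V - {a, b, c}"
  have "card {a, b, c} \<le> 3" using card_insert_le_m1[of 3 "{b,c}" a] card_insert_le_m1[of 2 "{c}" b] by simp
  then have cI: "card V - 3 \<le> card I"
    unfolding I_def using diff_card_le_card_Diff[of "{a, b, c}" V] by simp
  obtain S where S: "S \<subseteq> I" "card I \<le> 2 * card S"
    "\<And>u v. u \<in> S \<Longrightarrow> v \<in> S \<Longrightarrow> u \<noteq> v \<Longrightarrow> \<delta> \<le> pdist (q u) (q v)"
    using separated_half[of I] by (auto simp: I_def)
  \<comment> \<open>The factor 4 pays for the three corners, and halving turns it into 8.\<close>
  have "card V \<le> 4 * (card V - 3)" using assms by simp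
  then have nS: "card V \<le> 8 * card S" using cI S(2) by linarith
  have SV: "S \<subseteq> V" using S by (auto simp: I_def)
  have finS: "finite S" using SV finite_V finite_subset by blast
  \<comment> \<open>Since \<open>8 + 2 * \<delta> = 8 * (1 + \<beta>)\<close>, the sum in
    \<open>small\<close> is \<open>\<delta>^2 / 8 + \<delta>^2 / 16\<close>, below
    \<open>\<delta>^2 / 4\<close>. Thus \<open>hbox_dist\<close> with
    \<open>r = \<delta> / 4\<close> puts each box in the disc of radius
    \<open>\<delta> / 2\<close>.\<close>
  define \<alpha> \<beta> where "\<alpha> = \<delta> / sqrt (8 + 2 * \<delta>)" and "\<beta> = \<delta> / 4"
  have \<alpha>\<beta>: "\<alpha> \<ge> 0" "\<beta> \<ge> 0" using \<delta> by (auto simp: \<alpha>_def \<beta>_def)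
  have "(1 + \<beta>) * \<alpha>\<^sup>2 = \<delta>\<^sup>2 / 8"
  proof -
    have "\<alpha>\<^sup>2 = \<delta>\<^sup>2 / (8 * (1 + \<beta>))" using \<delta> by (simp add: \<alpha>_def \<beta>_def power_divide)
    then show ?thesis using \<alpha>\<beta> by (simp add: divide_simps) (simp add: algebra_simps)
  qed
  moreover have "\<beta>\<^sup>2 = \<delta>\<^sup>2 / 16" "4 * (\<delta> / 4)\<^sup>2 = \<delta>\<^sup>2 / 4" "\<delta>\<^sup>2 > 0"
    using \<delta> by (simp_all add: \<beta>_def power_divide)
  ultimately have small: "(1 + \<beta>) * \<alpha>\<^sup>2 + \<beta>\<^sup>2 < 4 * (\<delta> / 4)\<^sup>2" by linarith
  have box: "w > 0 \<and> pdist (q v) (pt x w) < \<delta> / 2" if "v \<in> V" "(x, w) \<in> hbox \<alpha> \<beta> (q v)" for v x w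
    using hbox_dist[OF dom[OF that(1)] \<alpha>\<beta> small _ that(2)] \<delta> by auto
  define B where "B v = hbox \<alpha> \<beta> (q v)" for v
  let ?M = "lborel \<Otimes>\<^sub>M lborel :: (real \<times> real) measure"
  have Bm: "B v \<in> sets ?M" for v unfolding B_def hbox_def by (intro pair_measureI) auto
  have disj: "disjoint_family_on B S"
    unfolding disjoint_family_on_def
  proof (intro ballI impI, rule ccontr)
    fix u v assume uv: "u \<in> S" "v \<in> S" "u \<noteq> v" and "B u \<inter> B v \<noteq> {}"
    then obtain x w where xw: "(x, w) \<in> B u" "(x, w) \<in> B v" by auto
    have V: "u \<in> V" "v \<in> V" using uv SV by auto
    have 1: "w > 0 \<and> pdist (q u) (pt x w) < \<delta> / 2" using box[OF V(1)] xw by (simp add: B_def)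
    have 2: "pdist (q v) (pt x w) < \<delta> / 2" using box[OF V(2)] xw by (simp add: B_def)
    have "pdist (q u) (q v) \<le> pdist (q u) (pt x w) + pdist (pt x w) (q v)"
      using 1 by (intro pdist_triangle dom V pt_dom) simp
    also have "\<dots> < \<delta>" using 1 2 by (simp add: pdist_commute[of "pt x w"])
    finally show False using S(3)[OF uv] by simp
  qed
  have "ennreal (real (card S) * (2 * \<alpha> * \<beta>)) = (\<Sum>v\<in>S. emeasure ?M (B v))"
    using SV dom \<alpha>\<beta> by (simp add: B_def emeasure_hbox subset_iff ennreal_mult ennreal_of_nat_eq_real_of_nat)
  also have "\<dots> = emeasure ?M (\<Union>v\<in>S. B v)"
    using Bm disj finS by (intro sum_emeasure) auto
  also have "\<dots> \<le> ennreal (3 * pi)"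
  proof (rule triangle_area_le[OF dom[OF abc(1)] dom[OF abc(2)] dom[OF abc(3)]])
    show "(\<Union>v\<in>S. B v) \<in> sets ?M" using Bm finS by auto
    fix x w assume "(x, w) \<in> (\<Union>v\<in>S. B v)"
    then obtain v where v: "v \<in> S" "(x, w) \<in> hbox \<alpha> \<beta> (q v)" by (auto simp: B_def)
    have w: "w > 0" "pdist (q v) (pt x w) < \<delta>" using box[OF _ v(2)] v SV \<delta> by force+
    show "w > 0 \<and> pt x w \<in> convex hull {q a, q b, q c}"
      using disc_in_triangle[OF tri _ pt_dom[OF w(1)] w(2)] w(1) v S(1) by (auto simp: I_def)
  qed
  finally have "real (card S) * (2 * \<alpha> * \<beta>) \<le> 3 * pi" by simp
  moreover have "2 * \<alpha> * \<beta> = \<delta>\<^sup>2 / (2 * sqrt (8 + 2 * \<delta>))"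
    by (simp add: \<alpha>_def \<beta>_def power2_eq_square)
  ultimately have "real (card S) * (\<delta>\<^sup>2 / (2 * sqrt (8 + 2 * \<delta>))) \<le> 3 * pi" by metis
  then have "real (card S) * \<delta>\<^sup>2 \<le> 6 * pi * sqrt (8 + 2 * \<delta>)"
    using \<delta> by (simp add: field_simps)
  moreover have "real (card V) * \<delta>\<^sup>2 \<le> 8 * real (card S) * \<delta>\<^sup>2"
    using nS by (intro mult_right_mono) auto
  ultimately show ?thesis by simp
qed

text \<open>The right-hand side of \<open>area_bound\<close> grows with \<open>\<delta>\<close>, so
  an absolute bound on \<open>\<delta>\<close> comes first, from \<open>n \<ge> 4\<close>; it makes
  the square root a constant.\<close>

lemma resolution_bound:
  assumes "card V \<ge> 4"
  shows "\<delta> \<le> 37 / sqrt (real (card V))"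
proof -
  define n where "n = real (card V)"
  have n: "n \<ge> 4" using assms by (simp add: n_def)
  define s where "s = sqrt (8 + 2 * \<delta>)"
  have s: "s > 0" "s\<^sup>2 = 8 + 2 * \<delta>" using \<delta> by (auto simp: s_def)
  have "n * \<delta>\<^sup>2 \<le> 48 * pi * s" using area_bound[OF assms] by (simp add: n_def s_def)
  also have "\<dots> \<le> 192 * s" using pi_less_4 s by simp
  finally have main: "n * \<delta>\<^sup>2 \<le> 192 * s" .
  have "4 * \<delta>\<^sup>2 \<le> n * \<delta>\<^sup>2" using n by (intro mult_right_mono) auto
  then have d2: "\<delta>\<^sup>2 \<le> 48 * s" using main by simp
  have "\<delta> < 18"
  proof (rule ccontr)
    assume "\<not> \<delta> < 18"
    then have d: "\<delta> \<ge> 18" by simp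
    have "(\<delta>\<^sup>2)\<^sup>2 \<le> (48 * s)\<^sup>2" using d2 by (intro power_mono) auto
    also have "\<dots> = 2304 * (8 + 2 * \<delta>)" by (simp add: power_mult_distrib s(2))
    \<comment> \<open>Here \<open>5832 = 18 ^ 3\<close>, and
      \<open>2304 * 8 < (5832 - 4608) * \<delta>\<close> from
      \<open>\<delta> \<ge> 18\<close>.\<close>
    also have "\<dots> < 5832 * \<delta>" using d by simp
    also have "\<dots> = 18 ^ 3 * \<delta>" by simp
    also have "\<dots> \<le> \<delta> ^ 3 * \<delta>" using d by (intro mult_right_mono power_mono) auto
    also have "\<dots> = (\<delta>\<^sup>2)\<^sup>2" by (simp add: power2_eq_square power3_eq_cube)
    finally show False by simp
  qed
  then have "s\<^sup>2 \<le> 7\<^sup>2" using s(2) by simp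
  then have "s \<le> 7" by (rule power2_le_imp_le) simp
  \<comment> \<open>From \<open>192 * 7 = 1344\<close> and \<open>37^2 = 1369\<close>.\<close>
  then have "n * \<delta>\<^sup>2 \<le> 37\<^sup>2" using main by simp
  then have "(\<delta> * sqrt n)\<^sup>2 \<le> 37\<^sup>2" using n by (simp add: power_mult_distrib mult.commute)
  then have "\<delta> * sqrt n \<le> 37" by (rule power2_le_imp_le) simp
  then show ?thesis using n by (simp add: n_def[symmetric] field_simps)
qed

end

section \<open>Transfer to the Poincare disk\<close>

text \<open>Disjointness and distance bounds for \<open>hseg\<close> pass to subsets, so this
  inclusion carries them to Euclidean segments.\<close>

lemma para_segment_in_hseg:
  assumes "a \<in> hyp_disk" "b \<in> hyp_disk" "y \<in> closed_segment (para a) (para b)"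
  obtains z where "z \<in> hseg a b" "z \<in> hyp_disk" "para z = y"
proof -
  note ab = para_in_dom[OF assms(1)] para_in_dom[OF assms(2)]
  obtain z where z: "z \<in> hyp_disk" "para z = y" using para_surj[OF pdist_segment(1)[OF ab assms(3)]] .
  have "z \<in> hseg a b"
    using pdist_segment(2)[OF ab assms(3)] z assms by (simp add: hseg_def hdist_eq_pdist)
  then show ?thesis using that z by blast
qed

theorem theorem1:
  "\<exists>C>0. \<forall>(V :: nat set) (E :: nat set set) (p :: nat \<Rightarrow> complex).
     maximal_planar V E \<longrightarrow> card V \<ge> 4 \<longrightarrow> hyp_straight_line_drawing V E p \<longrightarrow>
     vertex_edge_resolution V E p \<le> C / sqrt (real (card V))"
proof (intro exI[of _ 37] conjI allI impI)
  fix V :: "nat set" and E :: "nat set set" and p :: "nat \<Rightarrow> complex"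
  assume mp: "maximal_planar V E" and n: "card V \<ge> 4" and dr: "hyp_straight_line_drawing V E p"
  define q where "q = para \<circ> p"
  define \<delta> where "\<delta> = vertex_edge_resolution V E p"
  have graph: "simple_graph V E" using mp by (simp add: maximal_planar_def planar_def)
  have inV: "u \<in> V" "w \<in> V" if "{u, w} \<in> E" for u w 
    using graph that by (auto simp: simple_graph_def)
  have pdisk: "p v \<in> hyp_disk" if "v \<in> V" for v using dr that by (auto simp: hyp_straight_line_drawing_def)
  have seg: "\<exists>z \<in> hseg (p u) (p w). z \<in> hyp_disk \<and> para z = y" 
    if "{u, w} \<in> E" "y \<in> closed_segment (q u) (q w)" for u w y
    using para_segment_in_hseg[of "p u" "p w" y] that pdisk inV by (auto simp: q_def)
  have para_eqD: "z = w" if "z \<in> hyp_disk" "w \<in> hyp_disk" "para z = para w" for z w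
    using inj_on_para that by (auto dest: inj_onD)
  interpret maximal_straight_drawing V E q
  proof
    show "simple_graph V E" by (rule graph)
    have "inj_on p V" "p ` V \<subseteq> hyp_disk" using dr by (auto simp: hyp_straight_line_drawing_def)
    then show "inj_on q V" unfolding q_def
      by (intro comp_inj_on inj_on_subset[OF inj_on_para])
    show "\<not> planar V (insert {u, v} E)" if "u \<in> V" "v \<in> V" "u \<noteq> v" "{u, v} \<notin> E" for u v
      using mp that by (simp add: maximal_planar_def)
    show "q v \<notin> closed_segment (q u) (q w)" if v: "v \<in> V" "{u, w} \<in> E" "v \<notin> {u, w}" for v u w
    proof
      assume "q v \<in> closed_segment (q u) (q w)"
      then obtain z where z: "z \<in> hseg (p u) (p w)" "z \<in> hyp_disk" "para z = q v" 
        using seg v by blast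
      then have "z = p v" using para_eqD pdisk v by (simp add: q_def)
      then show False using dr v z by (auto simp: hyp_straight_line_drawing_def)
    qed
    show "closed_segment (q u) (q w) \<inter> closed_segment (q u') (q w') \<subseteq> q ` ({u, w} \<inter> {u', w'})"
      if e: "{u, w} \<in> E" "{u', w'} \<in> E" "{u, w} \<noteq> {u', w'}" for u w u' w'
    proof
      fix y assume "y \<in> closed_segment (q u) (q w) \<inter> closed_segment (q u') (q w')"
      then obtain z z' where z: "z \<in> hseg (p u) (p w)" "z \<in> hyp_disk" "para z = y"
          "z' \<in> hseg (p u') (p w')" "z' \<in> hyp_disk" "para z' = y"
        using seg[OF e(1)] seg[OF e(2)] by blast
      \<comment> \<open>Injectivity of \<open>para\<close> turns a common point of two segments into
        a common point of two geodesics.\<close>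
      have "z' = z" using para_eqD z by simp
      then have "z \<in> p ` ({u, w} \<inter> {u', w'})"
        using z dr e unfolding hyp_straight_line_drawing_def by blast
      then show "y \<in> q ` ({u, w} \<inter> {u', w'})" using z(3) by (force simp: q_def)
    qed
  qed
  show "vertex_edge_resolution V E p \<le> 37 / sqrt (real (card V))"
  proof (cases "\<delta> > 0")
    case False
    then have "\<delta> \<le> 0" by simp
    also have "0 \<le> 37 / sqrt (real (card V))" by simp
    finally show ?thesis by (simp add: \<delta>_def)
  next
    case True
    have nonneg: "0 \<le> hdist (p v) z" if "v \<in> V" "z \<in> hseg (p u) (p w)" for v u w z
      using that pdisk by (simp add: hseg_def hdist_eq_pdist pdist_nonneg para_in_dom)
    \<comment> \<open>Unfolds both infima of the resolution; each is a true lower bound because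
      distances are bounded below by 0.\<close>
    have lower: "\<delta> \<le> hdist (p v) z" if v: "v \<in> V" "{u, w} \<in> E" "v \<notin> {u, w}" "z \<in> hseg (p u) (p w)" for v u w z
    proof -
      have "\<delta> \<le> hdist_set (p v) (hseg (p u) (p w))"
        unfolding \<delta>_def vertex_edge_resolution_def
      proof (rule cInf_lower)
        show "bdd_below {hdist_set (p v) (hseg (p u) (p w)) |v u w. v \<in> V \<and> {u, w} \<in> E \<and> v \<notin> {u, w}}"
        proof (rule bdd_belowI[of _ 0], elim CollectE exE conjE, hypsubst)
          fix v u w assume "v \<in> V" "{u, w} \<in> E"
          have "q u \<in> closed_segment (q u) (q w)" by simp
          \<comment> \<open>The infimum over an empty set would be an arbitrary value.\<close>
          then have "hseg (p u) (p w) \<noteq> {}" using seg[OF \<open>{u, w} \<in> E\<close>] by blast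
          then show "0 \<le> hdist_set (p v) (hseg (p u) (p w))"
            unfolding hdist_set_def using nonneg[OF \<open>v \<in> V\<close>] by (intro cInf_greatest) auto
        qed
      qed (use v in blast)
      also have "\<dots> \<le> hdist (p v) z"
        unfolding hdist_set_def using v nonneg[OF v(1)] by (intro cInf_lower bdd_belowI[of _ 0]) auto
      finally show ?thesis .
    qed
    interpret separated_drawing V E q \<delta>
    proof
      show "\<delta> > 0" by (rule True)
      show "q v \<in> para_dom" if "v \<in> V" for v using that pdisk para_in_dom by (simp add: q_def)
      show "\<delta> \<le> pdist (q v) y" if v: "v \<in> V" "{u, w} \<in> E" "v \<notin> {u, w}" "y \<in> closed_segment (q u) (q w)" for v u w y
      proof -
        obtain z where z: "z \<in> hseg (p u) (p w)" "z \<in> hyp_disk" "para z = y" using seg v by blast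
        then show ?thesis using lower[OF v(1-3) z(1)] pdisk[OF v(1)] by (simp add: hdist_eq_pdist q_def)
      qed
    qed
    show ?thesis using resolution_bound[OF n] by (simp add: \<delta>_def)
  qed
qed simp

end
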